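(* Let $\{\mathfrak V_i\}_{i=1}^n$ be a finite family of full bundles of $\Omega$-spaces over the same base space $X$, and let $\mathsf E^\oplus=\{\langle\mathsf E_x^\oplus,\mathfrak n_x^\oplus\rangle\}_{x\in X}$ and $\mathcal E^\oplus$ be the family of locally convex spaces and the space of sections defined in the context. Then $\mathcal E^\oplus$ satisfies $FM(3)$–$FM(4)$ with respect to $\mathsf E^\oplus$.
   Context: Vector spaces are over $\mathbb K\in\{\mathbb R,\mathbb C\}$; Hlcs means Hausdorff locally convex space. Bundles. A bundle of $\Omega$-spaces $\langle\langle\mathfrak E,\tau\rangle,\pi,X,\mathfrak N\rangle$ (Gierz) consists of topological spaces $\langle\mathfrak E,\tau\rangle$ and $X$, a continuous open surjection $\pi:\mathfrak E\to X$, a vector space structure on each stalk $\mathfrak E_x=\pi^{-1}(x)$ such that addition $\{(a,b):\pi(a)=\pi(b)\}\to\mathfrak E$ and scalar multiplication are continuous, and a set $\mathfrak N=\{\nu_j:j\in J\}$ of functions $\mathfrak E\to[0,\infty[$ whose restrictions $\nu_j^x$ to each $\mathfrak E_x$ form a directed family of seminorms generating the (Hausdorff) topology induced by $\tau$ on $\mathfrak E_x$. For $U\subseteq X$, $\Gamma_U(\pi)$ is the set of continuous $\sigma:U\to\mathfrak E$ with $\sigma(x)\in\mathfrak E_x$ and $\sup_{x\in U}\nu_j(\sigma(x))<\infty$ for all $j$; $\Gamma(\pi)=\Gamma_X(\pi)$. The tubes $\{\beta:\pi(\beta)\in U,\nu_j(\beta-\sigma(\pi(\beta)))<\varepsilon\}$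 ($U$ open, $\sigma\in\Gamma_U(\pi)$, $\varepsilon>0$, $j\in J$) form a base of $\tau$. The bundle is full if each $\alpha\in\mathfrak E$ equals $\sigma(\pi(\alpha))$ for some $\sigma\in\Gamma(\pi)$. Data. $\mathfrak V_i=\langle\langle\mathfrak E_i,\tau_i\rangle,\pi_i,X,\mathfrak N_i\rangle$, $\mathfrak N_i=\{\nu_{i,l_i}:l_i\in L_i\}$, $\nu_{i,l_i}^x=\nu_{i,l_i}|_{(\mathfrak E_i)_x}$. Define $\mathsf E_x^\oplus=\bigoplus_{i=1}^n(\mathfrak E_i)_x$, with projections $\Pr_i^x$ and canonical inclusions $I_i^x$; $\mathfrak n_x^\oplus=\{\hat\mu^x_\rho:\rho\in\prod_{i=1}^nL_i\}$ with $\hat\mu_\rho^x=\sum_{i=1}^n\nu^x_{i,\rho_i}\circ\Pr_i^x$; and $\mathcal E^\oplus$ is the linear subspace of $\prod_{x\in X}\mathsf E_x^\oplus$ generated by all sections $x\mapsto I_i^x(f(x))$ with $1\le i\le n$ and $f\in\Gamma(\pi_i)$. $FM(3)$–$FM(4)$. Let $\{\langle V_x,\{\mu_j^x\}_{j\in J}\rangle\}_{x\in X}$ be a family of Hlcs with directed families of seminorms (same index set $J$) generating their topologies. $\mathcal G$ satisfies $FM(3)$–$FM(4)$ with respect to it if $\mathcal G$ is a linear subspace of $\{f\in\prod_xV_x:\sup_x\mu_j^x(f(x))<\infty\ \forall j\}$, $\{f(x):f\in\mathcal G\}$ is dense in $V_x$ for all $x\in X$ ($FM(3)$), and $x\mapsto\mu_j^x(f(x))$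 is upper semicontinuous on $X$ for all $j\in J$, $f\in\mathcal G$ ($FM(4)$). *)

theory Defs
  imports "HOL-Analysis.Analysis" "HOL-Algebra.Module"
begin

text \<open>
  The scalar field is a set \<open>K\<close> of complex numbers, either \<open>\<real>\<close> or \<open>UNIV\<close>. Vector spaces over it
  are modules over \<open>scalars K\<close>; the fields \<open>mult\<close> and \<open>one\<close> of a module record carry no meaning.
\<close>

definition scalars :: "complex set \<Rightarrow> complex ring" where
  "scalars K = \<lparr>carrier = K, mult = (*), one = 1, zero = 0, add = (+)\<rparr>"

definition product_module ::
    "'i set \<Rightarrow> ('i \<Rightarrow> (complex, 'v) module) \<Rightarrow> (complex, 'i \<Rightarrow> 'v) module" where
  "product_module I M =
     \<lparr>carrier = (\<Pi>\<^sub>E i\<in>I. carrier (M i)), mult = undefined, one = undefined,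
      zero = (\<lambda>i\<in>I. \<zero>\<^bsub>M i\<^esub>),
      add = (\<lambda>f g. \<lambda>i\<in>I. f i \<oplus>\<^bsub>M i\<^esub> g i),
      smult = (\<lambda>c f. \<lambda>i\<in>I. c \<odot>\<^bsub>M i\<^esub> f i)\<rparr>"

definition linear_hull :: "complex set \<Rightarrow> (complex, 'v) module \<Rightarrow> 'v set \<Rightarrow> 'v set" where
  "linear_hull K M S = \<Inter>{H. submodule H (scalars K) M \<and> S \<subseteq> H}"

definition seminorm_on :: "complex set \<Rightarrow> (complex, 'v) module \<Rightarrow> ('v \<Rightarrow> real) \<Rightarrow> bool" where
  "seminorm_on K M p \<longleftrightarrow>
     (\<forall>a\<in>carrier M. 0 \<le> p a) \<and>
     (\<forall>a\<in>carrier M. \<forall>b\<in>carrier M. p (a \<oplus>\<^bsub>M\<^esub> b) \<le> p a + p b) \<and>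
     (\<forall>c\<in>K. \<forall>a\<in>carrier M. p (c \<odot>\<^bsub>M\<^esub> a) = cmod c * p a)"

definition directed_seminorms ::
    "complex set \<Rightarrow> (complex, 'v) module \<Rightarrow> 'j set \<Rightarrow> ('j \<Rightarrow> 'v \<Rightarrow> real) \<Rightarrow> bool" where
  "directed_seminorms K M J p \<longleftrightarrow>
     J \<noteq> {} \<and> (\<forall>j\<in>J. seminorm_on K M (p j)) \<and>
     (\<forall>j\<in>J. \<forall>k\<in>J. \<exists>l\<in>J. \<forall>a\<in>carrier M. p j a \<le> p l a \<and> p k a \<le> p l a)"

definition seminorm_topology ::
    "(complex, 'v) module \<Rightarrow> 'j set \<Rightarrow> ('j \<Rightarrow> 'v \<Rightarrow> real) \<Rightarrow> 'v topology" where
  "seminorm_topology M J p =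
     topology_generated_by
       {{b \<in> carrier M. p j (b \<ominus>\<^bsub>M\<^esub> a) < \<epsilon>} | a j \<epsilon>. a \<in> carrier M \<and> j \<in> J \<and> 0 < \<epsilon>}"

definition hlcs ::
    "complex set \<Rightarrow> (complex, 'v) module \<Rightarrow> 'j set \<Rightarrow> ('j \<Rightarrow> 'v \<Rightarrow> real) \<Rightarrow> bool" where
  "hlcs K M J p \<longleftrightarrow>
     Module.module (scalars K) M \<and> directed_seminorms K M J p \<and>
     Hausdorff_space (seminorm_topology M J p)"

record ('e, 'x, 'l) seminormed_bundle =
  total_space :: "'e topology"
  proj :: "'e \<Rightarrow> 'x"
  stalk_zero :: "'x \<Rightarrow> 'e"
  stalk_add :: "'e \<Rightarrow> 'e \<Rightarrow> 'e"
  stalk_scale :: "complex \<Rightarrow> 'e \<Rightarrow> 'e"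
  sn_index :: "'l set"
  sn :: "'l \<Rightarrow> 'e \<Rightarrow> real"

definition stalk :: "('e, 'x, 'l) seminormed_bundle \<Rightarrow> 'x \<Rightarrow> (complex, 'e) module" where
  "stalk V x =
     \<lparr>carrier = {a \<in> topspace (total_space V). proj V a = x}, mult = undefined, one = undefined,
      zero = stalk_zero V x, add = stalk_add V, smult = stalk_scale V\<rparr>"

definition bounded_sections ::
    "'x topology \<Rightarrow> ('e, 'x, 'l) seminormed_bundle \<Rightarrow> 'x set \<Rightarrow> ('x \<Rightarrow> 'e) set" where
  "bounded_sections X V U =
     {\<sigma> \<in> (\<Pi>\<^sub>E x\<in>U. carrier (stalk V x)).
        continuous_map (subtopology X U) (total_space V) \<sigma> \<and>
        (\<forall>j\<in>sn_index V. bdd_above ((\<lambda>x. sn V j (\<sigma> x)) ` U))}"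

definition tube ::
    "('e, 'x, 'l) seminormed_bundle \<Rightarrow> 'x set \<Rightarrow> ('x \<Rightarrow> 'e) \<Rightarrow> 'l \<Rightarrow> real \<Rightarrow> 'e set" where
  "tube V U \<sigma> j \<epsilon> =
     {b \<in> topspace (total_space V). proj V b \<in> U \<and>
        sn V j (b \<ominus>\<^bsub>stalk V (proj V b)\<^esub> \<sigma> (proj V b)) < \<epsilon>}"

definition omega_bundle :: "complex set \<Rightarrow> 'x topology \<Rightarrow> ('e, 'x, 'l) seminormed_bundle \<Rightarrow> bool" where
  "omega_bundle K X V \<longleftrightarrow>
     continuous_map (total_space V) X (proj V) \<and>
     open_map (total_space V) X (proj V) \<and>
     proj V ` topspace (total_space V) = topspace X \<and>
     (\<forall>x\<in>topspace X.
        hlcs K (stalk V x) (sn_index V) (sn V) \<and>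
        subtopology (total_space V) (carrier (stalk V x)) =
          seminorm_topology (stalk V x) (sn_index V) (sn V)) \<and>
     continuous_map
       (subtopology (prod_topology (total_space V) (total_space V)) {(a, b). proj V a = proj V b})
       (total_space V) (\<lambda>(a, b). stalk_add V a b) \<and>
     continuous_map (prod_topology (top_of_set K) (total_space V))
       (total_space V) (\<lambda>(c, a). stalk_scale V c a) \<and>
     openin (total_space V) =
       arbitrary union_of
         (\<lambda>S. \<exists>U \<sigma> j \<epsilon>. openin X U \<and> \<sigma> \<in> bounded_sections X V U \<and> j \<in> sn_index V \<and> 0 < \<epsilon> \<and>
                S = tube V U \<sigma> j \<epsilon>)"

definition full_bundle :: "'x topology \<Rightarrow> ('e, 'x, 'l) seminormed_bundle \<Rightarrow> bool" where
  "full_bundle X V \<longleftrightarrow>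
     (\<forall>a\<in>topspace (total_space V). \<exists>\<sigma>\<in>bounded_sections X V (topspace X). \<sigma> (proj V a) = a)"

definition dsum_space :: "nat \<Rightarrow> (nat \<Rightarrow> ('e, 'x, 'l) seminormed_bundle) \<Rightarrow> 'x \<Rightarrow> (complex, nat \<Rightarrow> 'e) module" where
  "dsum_space n V x = product_module {1..n} (\<lambda>i. stalk (V i) x)"

definition dsum_incl :: "nat \<Rightarrow> (nat \<Rightarrow> ('e, 'x, 'l) seminormed_bundle) \<Rightarrow> 'x \<Rightarrow> nat \<Rightarrow> 'e \<Rightarrow> nat \<Rightarrow> 'e" where
  "dsum_incl n V x i a = (\<lambda>k\<in>{1..n}. if k = i then a else \<zero>\<^bsub>stalk (V k) x\<^esub>)"

definition dsum_index :: "nat \<Rightarrow> (nat \<Rightarrow> ('e, 'x, 'l) seminormed_bundle) \<Rightarrow> (nat \<Rightarrow> 'l) set" where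
  "dsum_index n V = (\<Pi>\<^sub>E i\<in>{1..n}. sn_index (V i))"

text \<open>
  The value does not mention the base point \<open>x\<close>: the seminorms of a bundle are defined on its whole
  total space, and \<open>dsum_seminorm n V x\<close> is only used on the carrier of \<open>dsum_space n V x\<close>.
\<close>

definition dsum_seminorm ::
    "nat \<Rightarrow> (nat \<Rightarrow> ('e, 'x, 'l) seminormed_bundle) \<Rightarrow> 'x \<Rightarrow> (nat \<Rightarrow> 'l) \<Rightarrow> (nat \<Rightarrow> 'e) \<Rightarrow> real" where
  "dsum_seminorm n V x \<rho> v = (\<Sum>i=1..n. sn (V i) (\<rho> i) (v i))"

definition dsum_sections ::
    "complex set \<Rightarrow> 'x topology \<Rightarrow> nat \<Rightarrow> (nat \<Rightarrow> ('e, 'x, 'l) seminormed_bundle) \<Rightarrow> ('x \<Rightarrow> nat \<Rightarrow> 'e) set" where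
  "dsum_sections K X n V =
     linear_hull K (product_module (topspace X) (dsum_space n V))
       {(\<lambda>x\<in>topspace X. dsum_incl n V x i (f x)) | i f.
          i \<in> {1..n} \<and> f \<in> bounded_sections X (V i) (topspace X)}"

definition upper_semicontinuous_map :: "'x topology \<Rightarrow> ('x \<Rightarrow> real) \<Rightarrow> bool" where
  "upper_semicontinuous_map X f \<longleftrightarrow> (\<forall>c. openin X {x \<in> topspace X. f x < c})"

definition FM3_FM4 ::
    "complex set \<Rightarrow> 'x topology \<Rightarrow> ('x \<Rightarrow> (complex, 'v) module) \<Rightarrow> 'j set \<Rightarrow>
     ('x \<Rightarrow> 'j \<Rightarrow> 'v \<Rightarrow> real) \<Rightarrow> ('x \<Rightarrow> 'v) set \<Rightarrow> bool" where
  "FM3_FM4 K X W J \<mu> G \<longleftrightarrow>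
     (\<forall>x\<in>topspace X. hlcs K (W x) J (\<mu> x)) \<and>
     submodule G (scalars K) (product_module (topspace X) W) \<and>
     (\<forall>f\<in>G. \<forall>j\<in>J. bdd_above ((\<lambda>x. \<mu> x j (f x)) ` topspace X)) \<and>
     (\<forall>x\<in>topspace X.
        seminorm_topology (W x) J (\<mu> x) closure_of {f x | f. f \<in> G} = carrier (W x)) \<and>
     (\<forall>j\<in>J. \<forall>f\<in>G. upper_semicontinuous_map X (\<lambda>x. \<mu> x j (f x)))"

end

theory Submission
  imports Defs
begin

text \<open>
  The sections generated by the inclusions of the \<open>\<Gamma>(\<pi>\<^sub>i)\<close> are exactly those all of whose components
  are bounded continuous sections: the latter form a linear space containing the generators, and each
  of them is a finite sum of generators. Fullness then makes the sections take every value in every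
  stalk of the direct sum, which is more than density. In a single bundle \<open>x \<mapsto> \<nu>\<^sub>j(\<sigma>(x))\<close> is upper
  semicontinuous because tubes around the zero section are open; boundedness and upper
  semicontinuity pass to the finite sums \<open>\<mu>\<^sub>\<rho>\<close>.
\<close>

section \<open>Scalar rings and products of modules\<close>

lemma carrier_scalars [simp]: "carrier (scalars K) = K"
  and one_scalars [simp]: "\<one>\<^bsub>scalars K\<^esub> = 1"
  and zero_scalars [simp]: "\<zero>\<^bsub>scalars K\<^esub> = 0"
  and add_scalars [simp]: "a \<oplus>\<^bsub>scalars K\<^esub> b = a + b"
  and mult_scalars [simp]: "a \<otimes>\<^bsub>scalars K\<^esub> b = a * b"
  by (simp_all add: scalars_def)

lemma cring_scalars:
  assumes "K = \<real> \<or> K = UNIV"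
  shows "cring (scalars K)"
proof -
  have closed: "0 \<in> K" "1 \<in> K" "\<And>a b. a \<in> K \<Longrightarrow> b \<in> K \<Longrightarrow> a + b \<in> K"
    "\<And>a b. a \<in> K \<Longrightarrow> b \<in> K \<Longrightarrow> a * b \<in> K" "\<And>a. a \<in> K \<Longrightarrow> - a \<in> K"
    using assms by auto
  show ?thesis
  proof (rule cringI)
    show "abelian_group (scalars K)"
      by (rule abelian_groupI) (auto simp: closed intro!: bexI[of _ "- _"])
    show "comm_monoid (scalars K)"
      by (rule comm_monoidI) (auto simp: closed)
  qed (auto simp: algebra_simps)
qed

lemma carrier_product_module [simp]:
    "carrier (product_module I M) = (\<Pi>\<^sub>E i\<in>I. carrier (M i))"
  and zero_product_module: "\<zero>\<^bsub>product_module I M\<^esub> = (\<lambda>i\<in>I. \<zero>\<^bsub>M i\<^esub>)"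
  and add_product_module: "f \<oplus>\<^bsub>product_module I M\<^esub> g = (\<lambda>i\<in>I. f i \<oplus>\<^bsub>M i\<^esub> g i)"
  and smult_product_module: "c \<odot>\<^bsub>product_module I M\<^esub> f = (\<lambda>i\<in>I. c \<odot>\<^bsub>M i\<^esub> f i)"
  by (simp_all add: product_module_def)

lemmas product_module_simps = zero_product_module add_product_module smult_product_module

text \<open>The operations act coordinatewise and extensionality settles arguments outside
  \<open>I\<close>, so each module axiom reduces to the same axiom in the factors.\<close>

lemma module_product_module:
  assumes "cring (scalars K)" and M: "\<And>i. i \<in> I \<Longrightarrow> Module.module (scalars K) (M i)"
  shows "Module.module (scalars K) (product_module I M)"
proof (rule moduleI)
  note ag = M[THEN module.axioms(2)]
  show "abelian_group (product_module I M)"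
  proof (rule abelian_groupI)
    fix f assume f: "f \<in> carrier (product_module I M)"
    show "\<exists>g\<in>carrier (product_module I M). g \<oplus>\<^bsub>product_module I M\<^esub> f = \<zero>\<^bsub>product_module I M\<^esub>"
      by (rule bexI[of _ "\<lambda>i\<in>I. \<ominus>\<^bsub>M i\<^esub> f i"])
         (use f ag in \<open>auto simp: product_module_simps PiE_iff abelian_group.l_neg
            abelian_group.a_inv_closed intro!: restrict_ext\<close>)
  qed (use ag in \<open>auto simp: product_module_simps PiE_iff abelian_groupE(1,2,3,5)
          fun_eq_iff extensional_def intro: abelian_groupE(4)\<close>)
qed (use assms in \<open>auto simp: product_module_simps PiE_iff module.smult_closed[of "scalars K"]
        module.smult_l_distr[of "scalars K", simplified] module.smult_r_distr[of "scalars K"]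
        module.smult_assoc1[of "scalars K", simplified]  module.smult_one[of "scalars K", simplified]
        fun_eq_iff extensional_def\<close>)

lemma product_module_a_inv:
  assumes "cring (scalars K)" and M: "\<And>i. i \<in> I \<Longrightarrow> Module.module (scalars K) (M i)"
    and f: "f \<in> carrier (product_module I M)"
  shows "\<ominus>\<^bsub>product_module I M\<^esub> f = (\<lambda>i\<in>I. \<ominus>\<^bsub>M i\<^esub> f i)"
proof -
  note ag = M[THEN module.axioms(2)]
  interpret P: Module.module "scalars K" "product_module I M"
    using assms by (intro module_product_module)
  show ?thesis
    by (rule P.minus_equality)
       (use f ag in \<open>auto simp: product_module_simps PiE_iff abelian_group.l_neg
            abelian_group.a_inv_closed intro!: restrict_ext\<close>)
qed

text \<open>Subtraction is derived from the record fields and not one of them. Its coordinatewise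
  form is what allows a seminorm of the direct sum to be evaluated on a difference.\<close>

lemma product_module_minus:
  assumes "cring (scalars K)" and M: "\<And>i. i \<in> I \<Longrightarrow> Module.module (scalars K) (M i)"
    and "f \<in> carrier (product_module I M)" "g \<in> carrier (product_module I M)"
  shows "f \<ominus>\<^bsub>product_module I M\<^esub> g = (\<lambda>i\<in>I. f i \<ominus>\<^bsub>M i\<^esub> g i)"
  using assms by (auto simp: a_minus_def product_module_a_inv add_product_module intro!: restrict_ext)

section \<open>Negation, submodules and linear hulls\<close>

lemma module_scalars_a_inv:
  assumes "Module.module (scalars K) M" "a \<in> carrier M" "-1 \<in> K"
  shows "\<ominus>\<^bsub>M\<^esub> a = (-1) \<odot>\<^bsub>M\<^esub> a"
proof -
  interpret Module.module "scalars K" M by fact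
  \<comment> \<open>The ring inverse is characterised inside the carrier \<open>K\<close>;
    uniqueness of inverses identifies it with complex negation.\<close>
  have "\<ominus>\<^bsub>scalars K\<^esub> 1 = -1"
    using R.one_closed assms(3) by (intro R.minus_equality) auto
  then show ?thesis
    using smult_l_minus[of 1 a] assms R.one_closed smult_one by simp
qed

text \<open>Closure under negation is absent from the premises because negation is scaling by
  \<open>-1\<close>.\<close>

lemma submodule_scalarsI:
  assumes "Module.module (scalars K) M" "-1 \<in> K"
    and "H \<subseteq> carrier M" "\<zero>\<^bsub>M\<^esub> \<in> H"
    and "\<And>a b. \<lbrakk>a \<in> H; b \<in> H\<rbrakk> \<Longrightarrow> a \<oplus>\<^bsub>M\<^esub> b \<in> H"
    and "\<And>c a. \<lbrakk>c \<in> K; a \<in> H\<rbrakk> \<Longrightarrow> c \<odot>\<^bsub>M\<^esub> a \<in> H"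
  shows "submodule H (scalars K) M"
  using assms by (intro module.submoduleI) (auto simp: module_scalars_a_inv subset_iff)

lemma submodule_linear_hull:
  assumes "Module.module (scalars K) M" "S \<subseteq> carrier M"
  shows "submodule (linear_hull K M S) (scalars K) M"
proof -
  interpret Module.module "scalars K" M by fact
  \<comment> \<open>The carrier is a member of the intersected family, which keeps the intersection
    inside \<open>carrier M\<close>.\<close>
  have carr: "carrier M \<in> {H. submodule H (scalars K) M \<and> S \<subseteq> H}"
    using carrier_is_submodule assms by auto
  show ?thesis
  proof (rule submoduleI)
    show "\<zero>\<^bsub>M\<^esub> \<in> linear_hull K M S"
      unfolding linear_hull_def by (auto dest!: submodule.axioms(1) dest: subgroup.one_closed)
  qed (use carr submoduleE in \<open>auto simp: linear_hull_def\<close>)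
qed

lemma subset_linear_hull: "S \<subseteq> linear_hull K M S"
  by (auto simp: linear_hull_def)

lemma linear_hull_minimal:
  "\<lbrakk>submodule H (scalars K) M; S \<subseteq> H\<rbrakk> \<Longrightarrow> linear_hull K M S \<subseteq> H"
  by (auto simp: linear_hull_def)

section \<open>Seminorms and the topologies they generate\<close>

text \<open>Homogeneity is applied with the scalar \<open>0\<close>, which lies in \<open>K\<close>
  because \<open>K\<close> is the carrier of a ring.\<close>

lemma seminorm_on_zero:
  assumes "Module.module (scalars K) M" "seminorm_on K M p"
  shows "p \<zero>\<^bsub>M\<^esub> = 0"
proof -
  interpret Module.module "scalars K" M by fact
  have "p (0 \<odot>\<^bsub>M\<^esub> \<zero>\<^bsub>M\<^esub>) = cmod 0 * p \<zero>\<^bsub>M\<^esub>"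
    using assms(2) R.zero_closed M.zero_closed unfolding seminorm_on_def by (metis carrier_scalars zero_scalars)
  then show ?thesis
    using R.zero_closed smult_r_null by simp
qed

text \<open>The two differences are negatives of each other, and \<open>-1\<close> has modulus
  1.\<close>

lemma seminorm_on_minus_commute:
  assumes "Module.module (scalars K) M" "seminorm_on K M p" "-1 \<in> K"
    and "a \<in> carrier M" "b \<in> carrier M"
  shows "p (a \<ominus>\<^bsub>M\<^esub> b) = p (b \<ominus>\<^bsub>M\<^esub> a)"
proof -
  interpret Module.module "scalars K" M by fact
  have "a \<ominus>\<^bsub>M\<^esub> b = \<ominus>\<^bsub>M\<^esub> (b \<ominus>\<^bsub>M\<^esub> a)"
    using assms by (simp add: M.minus_eq M.minus_add M.a_comm)
  also have "\<dots> = (-1) \<odot>\<^bsub>M\<^esub> (b \<ominus>\<^bsub>M\<^esub> a)"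
    using assms by (intro module_scalars_a_inv) auto
  finally show ?thesis
    using assms by (simp add: seminorm_on_def)
qed

lemma seminorm_on_triangle_minus:
  assumes "Module.module (scalars K) M" "seminorm_on K M p"
    and "a \<in> carrier M" "b \<in> carrier M" "c \<in> carrier M"
  shows "p (a \<ominus>\<^bsub>M\<^esub> c) \<le> p (a \<ominus>\<^bsub>M\<^esub> b) + p (b \<ominus>\<^bsub>M\<^esub> c)"
proof -
  interpret Module.module "scalars K" M by fact
  have "a \<ominus>\<^bsub>M\<^esub> c = (a \<ominus>\<^bsub>M\<^esub> b) \<oplus>\<^bsub>M\<^esub> (b \<ominus>\<^bsub>M\<^esub> c)"
    using assms by (simp add: M.minus_eq M.a_assoc M.r_neg1)
  then show ?thesis
    using assms by (simp add: seminorm_on_def)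
qed

text \<open>A generated topology lives on the union of its generators, and every vector lies in the
  unit ball around itself. Some ball exists since directedness includes that \<open>J\<close> is
  nonempty.\<close>

lemma topspace_seminorm_topology:
  assumes "Module.module (scalars K) M" "directed_seminorms K M J p"
  shows "topspace (seminorm_topology M J p) = carrier M"
proof -
  interpret Module.module "scalars K" M by fact
  obtain j where j: "j \<in> J" "seminorm_on K M (p j)"
    using assms(2) by (auto simp: directed_seminorms_def)
  have "p j (a \<ominus>\<^bsub>M\<^esub> a) < 1" if "a \<in> carrier M" for a
    using seminorm_on_zero[OF assms(1) j(2)] that by (simp add: M.minus_eq M.r_neg)
  then have mem: "a \<in> {b \<in> carrier M. p j (b \<ominus>\<^bsub>M\<^esub> a) < 1}" if "a \<in> carrier M" for a
    using that by simp
  let ?B = "{{b \<in> carrier M. p j (b \<ominus>\<^bsub>M\<^esub> a) < \<epsilon>} | a j \<epsilon>. a \<in> carrier M \<and> j \<in> J \<and> 0 < \<epsilon>}"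
  have "\<Union>?B = carrier M"
  proof (intro equalityI subsetI)
    fix a assume a: "a \<in> carrier M"
    have "{b \<in> carrier M. p j (b \<ominus>\<^bsub>M\<^esub> a) < 1} \<in> ?B"
      using a j(1) zero_less_one by blast
    with mem[OF a] show "a \<in> \<Union>?B"
      by (rule UnionI[rotated])
  qed auto
  then show ?thesis
    by (simp only: seminorm_topology_def topology_generated_by_topspace)
qed

text \<open>Turns the Hausdorff property into separation of vectors by seminorms. It is read
  forwards in each stalk and backwards in the direct sum.\<close>

lemma Hausdorff_seminorm_topology_iff:
  assumes M: "Module.module (scalars K) M" and J: "directed_seminorms K M J p" and "-1 \<in> K"
  shows "Hausdorff_space (seminorm_topology M J p) \<longleftrightarrow>
    (\<forall>a\<in>carrier M. \<forall>b\<in>carrier M. a \<noteq> b \<longrightarrow> (\<exists>j\<in>J. p j (a \<ominus>\<^bsub>M\<^esub> b) \<noteq> 0))"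
    (is "?H \<longleftrightarrow> ?S")
proof -
  interpret Module.module "scalars K" M by fact
  have sn: "seminorm_on K M (p j)" if "j \<in> J" for j
    using J that by (auto simp: directed_seminorms_def)
  note comm = seminorm_on_minus_commute[OF M sn \<open>-1 \<in> K\<close>]
  note tri = seminorm_on_triangle_minus[OF M sn]
  show ?thesis
  proof
    assume ?H
    show ?S
    proof (intro ballI impI, rule ccontr)
      fix a b assume ab: "a \<in> carrier M" "b \<in> carrier M" "a \<noteq> b"
        and "\<not> (\<exists>j\<in>J. p j (a \<ominus>\<^bsub>M\<^esub> b) \<noteq> 0)"
      then have 0: "p j (a \<ominus>\<^bsub>M\<^esub> b) = 0" "p j (b \<ominus>\<^bsub>M\<^esub> a) = 0" if "j \<in> J" for j
        using that comm by auto
      \<comment> \<open>The triangle inequality in both directions: points at distance zero have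
        equal distances to every centre.\<close>
      have eq: "p j (a \<ominus>\<^bsub>M\<^esub> c) = p j (b \<ominus>\<^bsub>M\<^esub> c)" if "j \<in> J" "c \<in> carrier M" for j c
        using tri[OF that(1) ab(1,2) that(2)] tri[OF that(1) ab(2,1) that(2)] 0[OF that(1)] by linarith
      \<comment> \<open>By \<open>eq\<close> no generating ball tells \<open>a\<close> and
        \<open>b\<close> apart, and this property survives intersections and unions.\<close>
      have indist: "a \<in> U \<longleftrightarrow> b \<in> U" if "openin (seminorm_topology M J p) U" for U
        using openin_topology_generated_by[OF that[unfolded seminorm_topology_def]]
        by induction (use ab eq in auto)
      have "a \<in> topspace (seminorm_topology M J p)" "b \<in> topspace (seminorm_topology M J p)"
        using topspace_seminorm_topology[OF M J] ab by auto
      then obtain U W where "openin (seminorm_topology M J p) U" "a \<in> U" "b \<in> W" "disjnt U W"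
        using \<open>?H\<close> ab(3) unfolding Hausdorff_space_def by metis
      then show False
        using indist[of U] by (auto simp: disjnt_iff)
    qed
  next
    assume ?S
    show ?H
      unfolding Hausdorff_space_def topspace_seminorm_topology[OF M J]
    proof (intro allI impI, elim conjE)
      fix a b assume ab: "a \<in> carrier M" "b \<in> carrier M" "a \<noteq> b"
      then obtain j where j: "j \<in> J" "p j (a \<ominus>\<^bsub>M\<^esub> b) \<noteq> 0"
        using \<open>?S\<close> by blast
      \<comment> \<open>Half the distance: a common point of the balls of radius \<open>d\<close>
        around \<open>a\<close> and \<open>b\<close> would put them at distance less than
        \<open>2 * d\<close>.\<close>
      define d where "d = p j (a \<ominus>\<^bsub>M\<^esub> b) / 2"
      have d: "d > 0"
        using j sn[OF j(1)] ab by (simp add: d_def seminorm_on_def less_le)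
      let ?B = "\<lambda>c. {x \<in> carrier M. p j (x \<ominus>\<^bsub>M\<^esub> c) < d}"
      have op: "openin (seminorm_topology M J p) (?B c)" if "c \<in> carrier M" for c
        unfolding seminorm_topology_def
        by (rule topology_generated_by_Basis) (use that j d in blast)
      have self: "p j (c \<ominus>\<^bsub>M\<^esub> c) = 0" if "c \<in> carrier M" for c
        using seminorm_on_zero[OF M sn[OF j(1)]] that by (simp add: M.minus_eq M.r_neg)
      have "disjnt (?B a) (?B b)"
      proof -
        have False if "x \<in> carrier M" "p j (x \<ominus>\<^bsub>M\<^esub> a) < d" "p j (x \<ominus>\<^bsub>M\<^esub> b) < d" for x
          using tri[OF j(1) ab(1) that(1) ab(2)] comm[OF j(1) ab(1) that(1)] that by (simp add: d_def)
        then show ?thesis by (auto simp: disjnt_iff)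
      qed
      then show "\<exists>U W. openin (seminorm_topology M J p) U \<and> openin (seminorm_topology M J p) W \<and>
          a \<in> U \<and> b \<in> W \<and> disjnt U W"
        using op ab self d by (intro exI[of _ "?B a"] exI[of _ "?B b"]) auto
    qed
  qed
qed

section \<open>Upper semicontinuity and boundedness of sums\<close>

lemma upper_semicontinuous_map_const: "upper_semicontinuous_map X (\<lambda>x. c)"
proof -
  have "{x \<in> topspace X. c < d} = (if c < d then topspace X else {})" for d
    by auto
  then show ?thesis
    by (simp add: upper_semicontinuous_map_def)
qed

lemma upper_semicontinuous_map_add:
  assumes "upper_semicontinuous_map X f" "upper_semicontinuous_map X g"
  shows "upper_semicontinuous_map X (\<lambda>x. f x + g x)"
  unfolding upper_semicontinuous_map_def
proof
  fix c
  \<comment> \<open>The threshold \<open>r\<close> is the midpoint between \<open>f x\<close> and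
    \<open>c - g x\<close>. It splits the condition on the sum into one on each summand, so the
    sublevel set is a union of open sets.\<close>
  have "\<exists>r. f x < r \<and> g x < c - r" if "f x + g x < c" for x
    using that by (intro exI[of _ "(f x + c - g x) / 2"]) (auto simp: field_simps)
  then have "{x \<in> topspace X. f x + g x < c} =
      (\<Union>r. {x \<in> topspace X. f x < r} \<inter> {x \<in> topspace X. g x < c - r})"
    by fastforce
  also have "openin X \<dots>"
    using assms by (intro openin_Union) (auto simp: upper_semicontinuous_map_def)
  finally show "openin X {x \<in> topspace X. f x + g x < c}" .
qed

text \<open>Induction on \<open>I\<close>; an infinite index set gives the constant sum
  \<open>0\<close> and is covered by the constant case.\<close>

lemma upper_semicontinuous_map_sum:
  assumes "\<And>i. i \<in> I \<Longrightarrow> upper_semicontinuous_map X (f i)"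
  shows "upper_semicontinuous_map X (\<lambda>x. \<Sum>i\<in>I. f i x)"
  using assms
  by (induction I rule: infinite_finite_induct)
     (auto intro: upper_semicontinuous_map_const upper_semicontinuous_map_add)

lemma upper_semicontinuous_map_cong:
  assumes "\<And>x. x \<in> topspace X \<Longrightarrow> f x = g x"
  shows "upper_semicontinuous_map X f \<longleftrightarrow> upper_semicontinuous_map X g"
proof -
  have "{x \<in> topspace X. f x < c} = {x \<in> topspace X. g x < c}" for c
    using assms by auto
  then show ?thesis by (simp add: upper_semicontinuous_map_def)
qed

lemma bdd_above_sum_image:
  fixes f :: "'i \<Rightarrow> 'x \<Rightarrow> real"
  assumes "\<And>i. i \<in> I \<Longrightarrow> bdd_above (f i ` A)"
  shows "bdd_above ((\<lambda>x. \<Sum>i\<in>I. f i x) ` A)"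
proof -
  \<comment> \<open>One bound is chosen for each index, uniform over \<open>A\<close>; the sum of
    these bounds works for the sum.\<close>
  obtain B where "\<And>i x. i \<in> I \<Longrightarrow> x \<in> A \<Longrightarrow> f i x \<le> B i"
    using assms unfolding bdd_above_def by (metis imageI)
  then show ?thesis
    by (intro bdd_aboveI2[of _ _ "sum B I"] sum_mono) auto
qed

section \<open>Stalks and global sections of a single bundle\<close>

lemma carrier_stalk: "carrier (stalk V x) = {a \<in> topspace (total_space V). proj V a = x}"
  and zero_stalk [simp]: "\<zero>\<^bsub>stalk V x\<^esub> = stalk_zero V x"
  and add_stalk [simp]: "a \<oplus>\<^bsub>stalk V x\<^esub> b = stalk_add V a b"
  and smult_stalk [simp]: "c \<odot>\<^bsub>stalk V x\<^esub> a = stalk_scale V c a"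
  by (simp_all add: stalk_def)

lemma omega_bundle_hlcs:
  assumes "omega_bundle K X V" "x \<in> topspace X"
  shows "hlcs K (stalk V x) (sn_index V) (sn V)"
  using assms by (auto simp: omega_bundle_def)

lemma omega_bundle_module:
  assumes "omega_bundle K X V" "x \<in> topspace X"
  shows "Module.module (scalars K) (stalk V x)"
  using omega_bundle_hlcs[OF assms] by (simp add: hlcs_def)

lemma omega_bundle_seminorm:
  assumes "omega_bundle K X V" "x \<in> topspace X" "j \<in> sn_index V"
  shows "seminorm_on K (stalk V x) (sn V j)"
  using omega_bundle_hlcs[OF assms(1,2)] assms(3) by (simp add: hlcs_def directed_seminorms_def)

text \<open>The space Gamma(pi) of the bundle. Its members are bounded for every seminorm, not
  merely continuous.\<close>

abbreviation global_sections :: "'x topology \<Rightarrow> ('e, 'x, 'l) seminormed_bundle \<Rightarrow> ('x \<Rightarrow> 'e) set" where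
  "global_sections X V \<equiv> bounded_sections X V (topspace X)"

lemma global_sections_iff:
  "\<sigma> \<in> global_sections X V \<longleftrightarrow>
     \<sigma> \<in> (\<Pi>\<^sub>E x\<in>topspace X. carrier (stalk V x)) \<and> continuous_map X (total_space V) \<sigma> \<and>
     (\<forall>j\<in>sn_index V. bdd_above ((\<lambda>x. sn V j (\<sigma> x)) ` topspace X))"
  by (simp add: bounded_sections_def)

text \<open>The pair of sections maps \<open>X\<close> into the fibre product on which addition is
  continuous, and the triangle inequality adds the bounds.\<close>

lemma global_sections_add:
  assumes V: "omega_bundle K X V" and \<sigma>: "\<sigma> \<in> global_sections X V" and \<tau>: "\<tau> \<in> global_sections X V"
  shows "(\<lambda>x\<in>topspace X. stalk_add V (\<sigma> x) (\<tau> x)) \<in> global_sections X V"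
proof -
  have st: "\<sigma> x \<in> carrier (stalk V x)" "\<tau> x \<in> carrier (stalk V x)" if "x \<in> topspace X" for x
    using \<sigma> \<tau> that by (auto simp: global_sections_iff)
  have "stalk_add V (\<sigma> x) (\<tau> x) \<in> carrier (stalk V x)" if "x \<in> topspace X" for x
    using abelian_groupE(1)[OF module.axioms(2)[OF omega_bundle_module[OF V that]]] st[OF that] by simp
  moreover have "continuous_map X (total_space V) (\<lambda>x\<in>topspace X. stalk_add V (\<sigma> x) (\<tau> x))"
  proof -
    have "continuous_map X
       (subtopology (prod_topology (total_space V) (total_space V)) {(a, b). proj V a = proj V b})
       (\<lambda>x. (\<sigma> x, \<tau> x))"
      using \<sigma> \<tau> st by (auto simp: continuous_map_in_subtopology continuous_map_pairedI
          global_sections_iff carrier_stalk)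
    moreover have "continuous_map
       (subtopology (prod_topology (total_space V) (total_space V)) {(a, b). proj V a = proj V b})
       (total_space V) (\<lambda>(a, b). stalk_add V a b)"
      using V by (simp add: omega_bundle_def)
    ultimately have "continuous_map X (total_space V) ((\<lambda>(a, b). stalk_add V a b) \<circ> (\<lambda>x. (\<sigma> x, \<tau> x)))"
      by (rule continuous_map_compose)
    then show ?thesis
      by (rule continuous_map_eq) auto
  qed
  moreover have "bdd_above ((\<lambda>x. sn V j ((\<lambda>x\<in>topspace X. stalk_add V (\<sigma> x) (\<tau> x)) x)) ` topspace X)"
    if j: "j \<in> sn_index V" for j
  proof -
    obtain A B where "\<And>x. x \<in> topspace X \<Longrightarrow> sn V j (\<sigma> x) \<le> A"
      "\<And>x. x \<in> topspace X \<Longrightarrow> sn V j (\<tau> x) \<le> B"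
      using \<sigma> \<tau> j unfolding global_sections_iff bdd_above_def by (metis (no_types, lifting) imageI)
    moreover have "sn V j (stalk_add V (\<sigma> x) (\<tau> x)) \<le> sn V j (\<sigma> x) + sn V j (\<tau> x)"
      if "x \<in> topspace X" for x
      using omega_bundle_seminorm[OF V that j] st[OF that] by (simp add: seminorm_on_def)
    ultimately show ?thesis
      by (intro bdd_aboveI2[of _ _ "A + B"]) (smt (verit) restrict_apply')
  qed
  ultimately show ?thesis
    by (auto simp: global_sections_iff)
qed

text \<open>Scaling is jointly continuous, so it may be composed with
  \<open>x \<mapsto> (c, \<sigma> x)\<close>; homogeneity scales the bounds.\<close>

lemma global_sections_scale:
  assumes V: "omega_bundle K X V" and \<sigma>: "\<sigma> \<in> global_sections X V" and c: "c \<in> K"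
  shows "(\<lambda>x\<in>topspace X. stalk_scale V c (\<sigma> x)) \<in> global_sections X V"
proof -
  have st: "\<sigma> x \<in> carrier (stalk V x)" if "x \<in> topspace X" for x
    using \<sigma> that by (auto simp: global_sections_iff)
  have "stalk_scale V c (\<sigma> x) \<in> carrier (stalk V x)" if "x \<in> topspace X" for x
    using module.smult_closed[OF omega_bundle_module[OF V that]] st[OF that] c by simp
  moreover have "continuous_map X (total_space V) (\<lambda>x\<in>topspace X. stalk_scale V c (\<sigma> x))"
  proof -
    have "continuous_map X (prod_topology (top_of_set K) (total_space V)) (\<lambda>x. (c, \<sigma> x))"
      using \<sigma> c by (auto simp: continuous_map_pairedI global_sections_iff)
    moreover have "continuous_map (prod_topology (top_of_set K) (total_space V))
       (total_space V) (\<lambda>(c, a). stalk_scale V c a)"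
      using V by (simp add: omega_bundle_def)
    ultimately have "continuous_map X (total_space V) ((\<lambda>(c, a). stalk_scale V c a) \<circ> (\<lambda>x. (c, \<sigma> x)))"
      by (rule continuous_map_compose)
    then show ?thesis
      by (rule continuous_map_eq) auto
  qed
  moreover have "bdd_above ((\<lambda>x. sn V j ((\<lambda>x\<in>topspace X. stalk_scale V c (\<sigma> x)) x)) ` topspace X)"
    if j: "j \<in> sn_index V" for j
  proof -
    obtain A where A: "\<And>x. x \<in> topspace X \<Longrightarrow> sn V j (\<sigma> x) \<le> A"
      using \<sigma> j unfolding global_sections_iff bdd_above_def by (metis (no_types, lifting) imageI)
    have "sn V j (stalk_scale V c (\<sigma> x)) = cmod c * sn V j (\<sigma> x)" if "x \<in> topspace X" for x
      using omega_bundle_seminorm[OF V that j] st[OF that] c by (simp add: seminorm_on_def)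
    then show ?thesis
      using A by (intro bdd_aboveI2[of _ _ "cmod c * A"]) (auto intro: mult_left_mono)
  qed
  ultimately show ?thesis
    by (auto simp: global_sections_iff)
qed

text \<open>Continuity of the zero section is obtained by scaling some global section by
  \<open>0\<close>; fullness supplies that section.\<close>

lemma global_sections_zero:
  assumes V: "omega_bundle K X V" "full_bundle X V"
  shows "(\<lambda>x\<in>topspace X. stalk_zero V x) \<in> global_sections X V"
proof (cases "topspace X = {}")
  case True
  then show ?thesis
    by (simp add: bounded_sections_def restrict_def)
next
  \<comment> \<open>A nonempty base has a nonempty total space by surjectivity of the projection, so
    fullness has a point to start from.\<close>
  case False
  then obtain a where "a \<in> topspace (total_space V)"
    using V(1) unfolding omega_bundle_def by (metis ex_in_conv image_empty)
  then obtain \<sigma> where \<sigma>: "\<sigma> \<in> global_sections X V"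
    using V by (auto simp: full_bundle_def)
  have eq: "stalk_scale V 0 (\<sigma> x) = stalk_zero V x" if "x \<in> topspace X" for x
    using module.smult_l_null[OF omega_bundle_module[OF V(1) that], of "\<sigma> x"] \<sigma> that
    by (auto simp: global_sections_iff)
  \<comment> \<open>The module structure of a stalk over any point of \<open>X\<close> makes
    \<open>K\<close> the carrier of a ring.\<close>
  have "0 \<in> K"
    using False omega_bundle_module[OF V(1)] cring.cring_simprules(2)[OF module.axioms(1)] by fastforce
  from global_sections_scale[OF V(1) \<sigma> this] show ?thesis
    by (simp add: eq cong: restrict_cong)
qed

text \<open>The set where the seminorm of a section is below \<open>c\<close> is the preimage of a tube around the
  zero section.\<close>

lemma upper_semicontinuous_map_global_section:
  assumes V: "omega_bundle K X V" "full_bundle X V" and \<sigma>: "\<sigma> \<in> global_sections X V"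
    and j: "j \<in> sn_index V"
  shows "upper_semicontinuous_map X (\<lambda>x. sn V j (\<sigma> x))"
  unfolding upper_semicontinuous_map_def
proof
  fix c
  have st: "\<sigma> x \<in> topspace (total_space V)" "proj V (\<sigma> x) = x" "\<sigma> x \<in> carrier (stalk V x)"
    if "x \<in> topspace X" for x
    using \<sigma> that by (auto simp: global_sections_iff carrier_stalk PiE_iff)
  show "openin X {x \<in> topspace X. sn V j (\<sigma> x) < c}"
  proof (cases "c > 0")
    \<comment> \<open>Tubes have positive radius, so nonpositive \<open>c\<close> is treated apart:
      seminorms are nonnegative and the set is empty.\<close>
    case False
    have "0 \<le> sn V j (\<sigma> x)" if "x \<in> topspace X" for x
      using omega_bundle_seminorm[OF V(1) that j] st[OF that] by (simp add: seminorm_on_def)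
    then have "{x \<in> topspace X. sn V j (\<sigma> x) < c} = {}"
      using False by fastforce
    then show ?thesis by (metis openin_empty)
  next
    case True
    let ?T = "tube V (topspace X) (\<lambda>x\<in>topspace X. stalk_zero V x) j c"
    have "openin (total_space V) ?T"
    proof -
      have "openin (total_space V) =
       arbitrary union_of
         (\<lambda>S. \<exists>U \<sigma> j \<epsilon>. openin X U \<and> \<sigma> \<in> bounded_sections X V U \<and> j \<in> sn_index V \<and> 0 < \<epsilon> \<and>
                S = tube V U \<sigma> j \<epsilon>)"
        using V(1) by (simp add: omega_bundle_def)
      then show ?thesis
        using global_sections_zero[OF V] j True by (auto intro!: arbitrary_union_of_inc)
    qed
    moreover have "continuous_map X (total_space V) \<sigma>"
      using \<sigma> by (simp add: global_sections_iff)
    ultimately have "openin X {x \<in> topspace X. \<sigma> x \<in> ?T}"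
      by (rule openin_continuous_map_preimage[rotated])
    \<comment> \<open>Subtracting the centre of the tube changes nothing, so membership of
      \<open>\<sigma> x\<close> in the tube says \<open>sn V j (\<sigma> x) < c\<close>.\<close>
    moreover have "\<sigma> x \<ominus>\<^bsub>stalk V x\<^esub> stalk_zero V x = \<sigma> x" if x: "x \<in> topspace X" for x
    proof -
      interpret Module.module "scalars K" "stalk V x"
        by (rule omega_bundle_module[OF V(1) x])
      have "\<sigma> x \<ominus>\<^bsub>stalk V x\<^esub> \<zero>\<^bsub>stalk V x\<^esub> = \<sigma> x"
        unfolding M.minus_eq using st[OF x] M.add.inv_one M.r_zero by (simp add: a_inv_def)
      then show ?thesis by simp
    qed
    ultimately show ?thesis
      using st by (simp add: tube_def cong: conj_cong)
  qed
qed

section \<open>The direct sum of stalks as a Hausdorff locally convex space\<close>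

lemma carrier_dsum_space [simp]:
  "carrier (dsum_space n V x) = (\<Pi>\<^sub>E i\<in>{1..n}. carrier (stalk (V i) x))"
  by (simp add: dsum_space_def)

lemma seminorm_on_dsum:
  assumes "\<And>i. i \<in> {1..n} \<Longrightarrow> seminorm_on K (stalk (V i) x) (sn (V i) (\<rho> i))"
  shows "seminorm_on K (dsum_space n V x) (dsum_seminorm n V x \<rho>)"
  unfolding seminorm_on_def
proof (intro conjI ballI)
  fix a assume "a \<in> carrier (dsum_space n V x)"
  then have a: "a i \<in> carrier (stalk (V i) x)" if "i \<in> {1..n}" for i
    using that by (auto simp: PiE_iff)
  then show "0 \<le> dsum_seminorm n V x \<rho> a"
    using assms unfolding dsum_seminorm_def seminorm_on_def by (intro sum_nonneg) blast
  show "dsum_seminorm n V x \<rho> (c \<odot>\<^bsub>dsum_space n V x\<^esub> a) = cmod c * dsum_seminorm n V x \<rho> a"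
    if "c \<in> K" for c
    using assms a that
    by (auto simp: dsum_seminorm_def dsum_space_def smult_product_module sum_distrib_left
        seminorm_on_def intro!: sum.cong)
  fix b assume "b \<in> carrier (dsum_space n V x)"
  then have b: "b i \<in> carrier (stalk (V i) x)" if "i \<in> {1..n}" for i
    using that by (auto simp: PiE_iff)
  show "dsum_seminorm n V x \<rho> (a \<oplus>\<^bsub>dsum_space n V x\<^esub> b) \<le>
      dsum_seminorm n V x \<rho> a + dsum_seminorm n V x \<rho> b"
    using assms a b
    by (auto simp: dsum_seminorm_def dsum_space_def add_product_module seminorm_on_def
        simp flip: sum.distrib intro!: sum_mono)
qed

text \<open>A dominating index is chosen in each bundle separately; the tuple of these dominates
  both sums term by term.\<close>

lemma directed_seminorms_dsum:
  assumes "\<And>i. i \<in> {1..n} \<Longrightarrow> directed_seminorms K (stalk (V i) x) (sn_index (V i)) (sn (V i))"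
  shows "directed_seminorms K (dsum_space n V x) (dsum_index n V) (dsum_seminorm n V x)"
  unfolding directed_seminorms_def
proof (intro conjI ballI)
  show "dsum_index n V \<noteq> {}"
    using assms by (auto simp: dsum_index_def directed_seminorms_def PiE_eq_empty_iff)
  show "seminorm_on K (dsum_space n V x) (dsum_seminorm n V x \<rho>)" if "\<rho> \<in> dsum_index n V" for \<rho>
    using assms that
    by (intro seminorm_on_dsum) (auto simp: dsum_index_def directed_seminorms_def PiE_iff)
  fix \<rho> \<rho>' assume \<rho>: "\<rho> \<in> dsum_index n V" "\<rho>' \<in> dsum_index n V"
  have "\<exists>l. l \<in> sn_index (V i) \<and> (\<forall>a\<in>carrier (stalk (V i) x).
      sn (V i) (\<rho> i) a \<le> sn (V i) l a \<and> sn (V i) (\<rho>' i) a \<le> sn (V i) l a)" if i: "i \<in> {1..n}" for i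
  proof -
    have "\<rho> i \<in> sn_index (V i)" "\<rho>' i \<in> sn_index (V i)"
      using \<rho> i by (auto simp: dsum_index_def PiE_iff)
    then show ?thesis
      using assms[OF i] unfolding directed_seminorms_def by blast
  qed
  then obtain l where l: "\<And>i. i \<in> {1..n} \<Longrightarrow> l i \<in> sn_index (V i)"
    "\<And>i a. i \<in> {1..n} \<Longrightarrow> a \<in> carrier (stalk (V i) x) \<Longrightarrow>
      sn (V i) (\<rho> i) a \<le> sn (V i) (l i) a \<and> sn (V i) (\<rho>' i) a \<le> sn (V i) (l i) a"
    by metis
  show "\<exists>l\<in>dsum_index n V. \<forall>a\<in>carrier (dsum_space n V x).
      dsum_seminorm n V x \<rho> a \<le> dsum_seminorm n V x l a \<and>
      dsum_seminorm n V x \<rho>' a \<le> dsum_seminorm n V x l a"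
    \<comment> \<open>Restriction makes the chosen tuple extensional, as membership in
      \<open>dsum_index\<close> demands.\<close>
    by (rule bexI[of _ "restrict l {1..n}"])
       (use l in \<open>auto simp: dsum_index_def dsum_seminorm_def PiE_iff intro!: sum_mono\<close>)
qed

text \<open>Distinct vectors differ in some coordinate, where the Hausdorff stalk provides a
  separating seminorm. Any index tuple using that seminorm in this coordinate separates them in the
  sum.\<close>

lemma hlcs_dsum:
  assumes "cring (scalars K)" "-1 \<in> K"
    and V: "\<And>i. i \<in> {1..n} \<Longrightarrow> hlcs K (stalk (V i) x) (sn_index (V i)) (sn (V i))"
  shows "hlcs K (dsum_space n V x) (dsum_index n V) (dsum_seminorm n V x)"
proof -
  have modV: "Module.module (scalars K) (stalk (V i) x)"
    and dirV: "directed_seminorms K (stalk (V i) x) (sn_index (V i)) (sn (V i))"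
    if "i \<in> {1..n}" for i
    using V[OF that] by (auto simp: hlcs_def)
  have mod: "Module.module (scalars K) (dsum_space n V x)"
    unfolding dsum_space_def by (intro module_product_module assms modV)
  have dir: "directed_seminorms K (dsum_space n V x) (dsum_index n V) (dsum_seminorm n V x)"
    by (intro directed_seminorms_dsum dirV)
  have "\<exists>\<rho>\<in>dsum_index n V. dsum_seminorm n V x \<rho> (a \<ominus>\<^bsub>dsum_space n V x\<^esub> b) \<noteq> 0"
    if a: "a \<in> carrier (dsum_space n V x)" and b: "b \<in> carrier (dsum_space n V x)" and "a \<noteq> b" for a b
  proof -
    have ab: "a i \<in> carrier (stalk (V i) x)" "b i \<in> carrier (stalk (V i) x)" if "i \<in> {1..n}" for i
      using a b that by (auto simp: PiE_iff)
    obtain i where i: "i \<in> {1..n}" "a i \<noteq> b i"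
      using a b \<open>a \<noteq> b\<close> unfolding carrier_dsum_space by (meson PiE_ext)
    obtain j where j: "j \<in> sn_index (V i)" "sn (V i) j (a i \<ominus>\<^bsub>stalk (V i) x\<^esub> b i) \<noteq> 0"
      using Hausdorff_seminorm_topology_iff[OF modV dirV \<open>-1 \<in> K\<close>, OF i(1) i(1)] V[OF i(1)]
        ab[OF i(1)] i(2) by (auto simp: hlcs_def)
    \<comment> \<open>An arbitrary tuple fills the other coordinates; only its entry at
      \<open>i\<close> is then replaced by \<open>j\<close>.\<close>
    obtain \<rho> where \<rho>: "\<rho> \<in> dsum_index n V"
      using dir by (auto simp: directed_seminorms_def)
    define \<rho>' where "\<rho>' = \<rho>(i := j)"
    have \<rho>': "\<rho>' \<in> dsum_index n V"
      using \<rho> i j by (auto simp: \<rho>'_def dsum_index_def PiE_iff extensional_def)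
    \<comment> \<open>With all terms nonnegative, the nonzero term at \<open>i\<close> cannot be
      cancelled in the sum.\<close>
    have nonneg: "0 \<le> sn (V k) (\<rho>' k) (a k \<ominus>\<^bsub>stalk (V k) x\<^esub> b k)" if k: "k \<in> {1..n}" for k
    proof -
      interpret Module.module "scalars K" "stalk (V k) x"
        by (rule modV[OF k])
      have "\<rho>' k \<in> sn_index (V k)"
        using \<rho>' k by (auto simp: dsum_index_def)
      then show ?thesis
        using dirV[OF k] ab[OF k] by (simp add: directed_seminorms_def seminorm_on_def)
    qed
    have "dsum_seminorm n V x \<rho>' (a \<ominus>\<^bsub>dsum_space n V x\<^esub> b) =
        (\<Sum>k=1..n. sn (V k) (\<rho>' k) (a k \<ominus>\<^bsub>stalk (V k) x\<^esub> b k))"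
      using a b unfolding dsum_space_def dsum_seminorm_def
      by (subst product_module_minus[OF assms(1) modV]) auto
    also have "\<dots> \<noteq> 0"
      using nonneg i(1) j(2) by (subst sum_nonneg_eq_0_iff) (auto simp: \<rho>'_def)
    finally show ?thesis
      using \<rho>' by blast
  qed
  then show ?thesis
    unfolding hlcs_def using mod dir Hausdorff_seminorm_topology_iff[OF mod dir \<open>-1 \<in> K\<close>] by blast
qed

section \<open>Componentwise description of the generated section space\<close>

text \<open>Membership in the hull becomes a test on each component, which is how boundedness, upper
  semicontinuity and density are later reduced to the single bundles.\<close>

lemma dsum_sections_eq:
  assumes K: "cring (scalars K)" "-1 \<in> K"
    and V: "\<And>i. i \<in> {1..n} \<Longrightarrow> omega_bundle K X (V i)"
    and full: "\<And>i. i \<in> {1..n} \<Longrightarrow> full_bundle X (V i)"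
  shows "dsum_sections K X n V =
    {f \<in> (\<Pi>\<^sub>E x\<in>topspace X. carrier (dsum_space n V x)).
      \<forall>i\<in>{1..n}. (\<lambda>x\<in>topspace X. f x i) \<in> global_sections X (V i)}" (is "?D = ?H")
    and "submodule (dsum_sections K X n V) (scalars K)
      (product_module (topspace X) (dsum_space n V))"
proof -
  let ?P = "product_module (topspace X) (dsum_space n V)"
  let ?G = "{(\<lambda>x\<in>topspace X. dsum_incl n V x i (f x)) | i f.
          i \<in> {1..n} \<and> f \<in> global_sections X (V i)}"
  have modV: "Module.module (scalars K) (stalk (V i) x)" if "i \<in> {1..n}" "x \<in> topspace X" for i x
    using omega_bundle_module[OF V] that by blast
  have modD: "Module.module (scalars K) (dsum_space n V x)" if "x \<in> topspace X" for x
    unfolding dsum_space_def by (intro module_product_module K modV that)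
  have modP: "Module.module (scalars K) ?P"
    by (intro module_product_module K modD)
  interpret P: Module.module "scalars K" ?P by (rule modP)
  have zero_in: "stalk_zero (V i) x \<in> carrier (stalk (V i) x)"
    if "i \<in> {1..n}" "x \<in> topspace X" for i x
    using abelian_groupE(2)[OF module.axioms(2)[OF modV[OF that]]] by simp
  \<comment> \<open>Each closure property is inherited in every component from the corresponding
    closure of Gamma(pi_i).\<close>
  have H: "submodule ?H (scalars K) ?P"
  proof (rule submodule_scalarsI[OF modP K(2)])
    show "?H \<subseteq> carrier ?P" by auto
    show "\<zero>\<^bsub>?P\<^esub> \<in> ?H"
    proof -
      have "(\<lambda>x\<in>topspace X. \<zero>\<^bsub>?P\<^esub> x i) = (\<lambda>x\<in>topspace X. stalk_zero (V i) x)" if "i \<in> {1..n}" for i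
        using that by (auto simp: dsum_space_def zero_product_module intro!: restrict_ext)
      then show ?thesis
        using P.zero_closed global_sections_zero[OF V full] by auto
    qed
    fix f assume f: "f \<in> ?H"
    show "c \<odot>\<^bsub>?P\<^esub> f \<in> ?H" if "c \<in> K" for c
    proof -
      have "(\<lambda>x\<in>topspace X. (c \<odot>\<^bsub>?P\<^esub> f) x i) \<in> global_sections X (V i)" if i: "i \<in> {1..n}" for i
      proof -
        have "(\<lambda>x\<in>topspace X. (c \<odot>\<^bsub>?P\<^esub> f) x i) =
            (\<lambda>x\<in>topspace X. stalk_scale (V i) c ((\<lambda>x\<in>topspace X. f x i) x))"
          using i by (auto simp: dsum_space_def smult_product_module intro!: restrict_ext)
        also have "\<dots> \<in> global_sections X (V i)"
          using f i \<open>c \<in> K\<close> by (intro global_sections_scale[OF V, of i "\<lambda>x\<in>topspace X. f x i"]) auto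
        finally show ?thesis .
      qed
      then show ?thesis
        using P.smult_closed[of c f] f that by auto
    qed
    fix g assume g: "g \<in> ?H"
    have "(\<lambda>x\<in>topspace X. (f \<oplus>\<^bsub>?P\<^esub> g) x i) \<in> global_sections X (V i)" if i: "i \<in> {1..n}" for i
    proof -
      have "(\<lambda>x\<in>topspace X. (f \<oplus>\<^bsub>?P\<^esub> g) x i) =
          (\<lambda>x\<in>topspace X. stalk_add (V i) ((\<lambda>x\<in>topspace X. f x i) x) ((\<lambda>x\<in>topspace X. g x i) x))"
        using i by (auto simp: dsum_space_def add_product_module intro!: restrict_ext)
      also have "\<dots> \<in> global_sections X (V i)"
        using f g i
        by (intro global_sections_add[OF V, of i "\<lambda>x\<in>topspace X. f x i" "\<lambda>x\<in>topspace X. g x i"]) auto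
      finally show ?thesis .
    qed
    then show "f \<oplus>\<^bsub>?P\<^esub> g \<in> ?H"
      using P.a_closed[of f g] f g by auto
  qed
  have "?G \<subseteq> ?H"
  proof
    fix s assume "s \<in> ?G"
    then obtain i f where s: "s = (\<lambda>x\<in>topspace X. dsum_incl n V x i (f x))"
      and i: "i \<in> {1..n}" and f: "f \<in> global_sections X (V i)"
      by blast
    have "(\<lambda>x\<in>topspace X. dsum_incl n V x i (f x)) \<in> (\<Pi>\<^sub>E x\<in>topspace X. carrier (dsum_space n V x))"
      using f zero_in by (auto simp: dsum_incl_def global_sections_iff PiE_iff)
    \<comment> \<open>A generator has \<open>f\<close> as its component \<open>i\<close> and the
      zero section elsewhere, so the zero section has to be known to be bounded and
      continuous.\<close>
    moreover have "(\<lambda>x\<in>topspace X. (\<lambda>x\<in>topspace X. dsum_incl n V x i (f x)) x k) =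
        (if k = i then f else (\<lambda>x\<in>topspace X. stalk_zero (V k) x))" if "k \<in> {1..n}" for k
      using that f
      by (auto simp: dsum_incl_def global_sections_iff fun_eq_iff PiE_iff extensional_def)
    ultimately show "s \<in> ?H"
      unfolding s using f global_sections_zero[OF V full] by auto
  qed
  moreover have "?H \<subseteq> carrier ?P" by auto
  ultimately show D: "submodule ?D (scalars K) ?P"
    unfolding dsum_sections_def by (intro submodule_linear_hull[OF modP]) blast
  have "?D \<subseteq> ?H"
    unfolding dsum_sections_def by (rule linear_hull_minimal[OF H \<open>?G \<subseteq> ?H\<close>])
  moreover have "?H \<subseteq> ?D"
  proof
    fix f assume f: "f \<in> ?H"
    \<comment> \<open>The truncation of \<open>f\<close> to its first \<open>k\<close> components.
      It runs from the zero section at \<open>k = 0\<close> to \<open>f\<close> at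
      \<open>k = n\<close>, and each step adds one generator.\<close>
    define g where "g = (\<lambda>k. \<lambda>x\<in>topspace X. \<lambda>i\<in>{1..n}. if i \<le> k then f x i else stalk_zero (V i) x)"
    have fx: "f x i \<in> carrier (stalk (V i) x)" if "x \<in> topspace X" "i \<in> {1..n}" for x i
      using f that by (auto simp: PiE_iff)
    have "g k \<in> ?D" if "k \<le> n" for k
      using that
    proof (induction k)
      case 0
      have "g 0 = \<zero>\<^bsub>?P\<^esub>"
        by (auto simp: g_def dsum_space_def zero_product_module intro!: restrict_ext)
      then show ?case
        using submodule.axioms(1)[OF D] subgroup.one_closed by fastforce
    next
      case (Suc k)
      let ?s = "\<lambda>x\<in>topspace X. dsum_incl n V x (Suc k) ((\<lambda>x\<in>topspace X. f x (Suc k)) x)"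
      have "?s \<in> ?D"
      proof -
        have "(\<lambda>x\<in>topspace X. f x (Suc k)) \<in> global_sections X (V (Suc k))"
          using f Suc.prems by auto
        then have "?s \<in> ?G"
          using Suc.prems by fastforce
        then show ?thesis
          unfolding dsum_sections_def by (rule subsetD[OF subset_linear_hull])
      qed
      moreover have "g (Suc k) = g k \<oplus>\<^bsub>?P\<^esub> ?s"
      proof -
        \<comment> \<open>In every coordinate at least one summand is zero: the new generator for
          \<open>i \<le> k\<close>, the truncation for \<open>i = Suc k\<close>, both
          beyond.\<close>
        have "(if i \<le> Suc k then f x i else stalk_zero (V i) x) =
          stalk_add (V i) (if i \<le> k then f x i else stalk_zero (V i) x)
             (if i = Suc k then f x (Suc k) else stalk_zero (V i) x)"
          if x: "x \<in> topspace X" and i: "i \<in> {1..n}" for x i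
        proof -
          interpret Module.module "scalars K" "stalk (V i) x"
            by (rule modV[OF i x])
          show ?thesis
            using fx[OF x i] M.l_zero[of "f x i"] M.r_zero[of "f x i"] M.l_zero[OF M.zero_closed]
            by (cases "i \<le> k"; cases "i = Suc k") auto
        qed
        then show ?thesis
          by (auto simp: g_def dsum_space_def add_product_module dsum_incl_def intro!: restrict_ext)
      qed
      ultimately show ?case
        using module.submoduleE(5)[OF modP D] Suc by simp
    qed
    moreover have "g n = f"
      using f by (auto simp: g_def fun_eq_iff PiE_iff extensional_def)
    ultimately show "f \<in> ?D" by auto
  qed
  ultimately show "?D = ?H" by blast
qed

section \<open>Verification of FM(3)-FM(4) for the direct sum\<close>

theorem lemma1p3p4:
  fixes K :: "complex set"
    and X :: "'x topology"
    and n :: nat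
    and V :: "nat \<Rightarrow> ('e, 'x, 'l) seminormed_bundle"
  assumes "K = \<real> \<or> K = UNIV"
    and "\<And>i. i \<in> {1..n} \<Longrightarrow> omega_bundle K X (V i)"
    and "\<And>i. i \<in> {1..n} \<Longrightarrow> full_bundle X (V i)"
  shows "FM3_FM4 K X (dsum_space n V) (dsum_index n V) (dsum_seminorm n V)
           (dsum_sections K X n V)"
proof -
  note V = assms(2) and full = assms(3)
  have K: "cring (scalars K)" "-1 \<in> K"
    using cring_scalars[OF assms(1)] assms(1) by auto
  have D: "dsum_sections K X n V =
      {f \<in> (\<Pi>\<^sub>E x\<in>topspace X. carrier (dsum_space n V x)).
        \<forall>i\<in>{1..n}. (\<lambda>x\<in>topspace X. f x i) \<in> global_sections X (V i)}"
    by (rule dsum_sections_eq(1)[OF K V full])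
  have sub: "submodule (dsum_sections K X n V) (scalars K)
      (product_module (topspace X) (dsum_space n V))"
    by (rule dsum_sections_eq(2)[OF K V full])
  have hl: "hlcs K (dsum_space n V x) (dsum_index n V) (dsum_seminorm n V x)"
    if "x \<in> topspace X" for x
    by (intro hlcs_dsum K omega_bundle_hlcs[OF V] that)
  have comp: "(\<lambda>x\<in>topspace X. f x i) \<in> global_sections X (V i)" "\<rho> i \<in> sn_index (V i)"
    if "f \<in> dsum_sections K X n V" "\<rho> \<in> dsum_index n V" "i \<in> {1..n}" for f \<rho> i
    using that by (auto simp: D dsum_index_def PiE_iff)
  have bdd: "bdd_above ((\<lambda>x. dsum_seminorm n V x \<rho> (f x)) ` topspace X)"
    if "f \<in> dsum_sections K X n V" "\<rho> \<in> dsum_index n V" for f \<rho>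
    unfolding dsum_seminorm_def
  proof (rule bdd_above_sum_image)
    fix i assume "i \<in> {1..n}"
    then show "bdd_above ((\<lambda>x. sn (V i) (\<rho> i) (f x i)) ` topspace X)"
      using comp[OF that] by (auto simp: global_sections_iff cong: image_cong)
  qed
  have usc: "upper_semicontinuous_map X (\<lambda>x. dsum_seminorm n V x \<rho> (f x))"
    if "f \<in> dsum_sections K X n V" "\<rho> \<in> dsum_index n V" for f \<rho>
    unfolding dsum_seminorm_def
  proof (rule upper_semicontinuous_map_sum)
    fix i assume i: "i \<in> {1..n}"
    \<comment> \<open>The single-bundle result speaks of the component restricted to
      \<open>topspace X\<close>; congruence on \<open>topspace X\<close> removes the
      restriction.\<close>
    show "upper_semicontinuous_map X (\<lambda>x. sn (V i) (\<rho> i) (f x i))"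
      using upper_semicontinuous_map_global_section[OF V[OF i] full[OF i] comp[OF that i]]
      by (subst (asm) upper_semicontinuous_map_cong) auto
  qed
  have dense: "{f x | f. f \<in> dsum_sections K X n V} = carrier (dsum_space n V x)"
    if x: "x \<in> topspace X" for x
  proof (intro equalityI subsetI)
    fix v assume v: "v \<in> carrier (dsum_space n V x)"
    \<comment> \<open>Fullness of the bundle \<open>V i\<close> at the point \<open>v i\<close>,
      which projects to \<open>x\<close>. The sections so chosen become the components of one
      section through \<open>v\<close>.\<close>
    have "\<exists>s. s \<in> global_sections X (V i) \<and> s x = v i" if i: "i \<in> {1..n}" for i
      using full[OF i] v i by (fastforce simp: full_bundle_def PiE_iff carrier_stalk)
    then obtain s where s: "\<And>i. i \<in> {1..n} \<Longrightarrow> s i \<in> global_sections X (V i) \<and> s i x = v i"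
      by metis
    define f where "f = (\<lambda>y\<in>topspace X. \<lambda>i\<in>{1..n}. s i y)"
    have "(\<lambda>y\<in>topspace X. f y i) = s i" if i: "i \<in> {1..n}" for i
      using s[OF i] i by (auto simp: f_def fun_eq_iff global_sections_iff PiE_iff extensional_def)
    moreover have "f \<in> (\<Pi>\<^sub>E x\<in>topspace X. carrier (dsum_space n V x))"
      using s by (auto simp: f_def global_sections_iff PiE_iff)
    ultimately have "f \<in> dsum_sections K X n V"
      using s by (auto simp: D)
    moreover have "f x = v"
      using s v x by (auto simp: f_def fun_eq_iff PiE_iff extensional_def)
    ultimately show "v \<in> {f x | f. f \<in> dsum_sections K X n V}" by blast
  qed (use x in \<open>auto simp: D\<close>)
  \<comment> \<open>The values already exhaust the carrier, which is the whole topological space and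
    hence its own closure.\<close>
  have closure: "seminorm_topology (dsum_space n V x) (dsum_index n V) (dsum_seminorm n V x) closure_of
      {f x | f. f \<in> dsum_sections K X n V} = carrier (dsum_space n V x)" if "x \<in> topspace X" for x
    using topspace_seminorm_topology[of K "dsum_space n V x" "dsum_index n V" "dsum_seminorm n V x"]
      hl[OF that] closure_of_topspace unfolding dense[OF that] hlcs_def by metis
  show ?thesis
    unfolding FM3_FM4_def by (intro conjI ballI hl sub bdd closure usc)
qed

end
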